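(* Let $X$ be a topological space. Then $X$ is slightly $e^*$-$\theta$-$R_0$ if and only if $e^*\text{-}ker_\theta(\{x\})\neq X$ for every $x\in X$.
   Context: No separation axioms are assumed on topological spaces. For a subset $A$ of a topological space $X$, $cl(A)$ and $int(A)$ denote closure and interior, and $\delta\text{-}cl(A)=\{x\in X : int(cl(U))\cap A\neq\emptyset \text{ for every open } U \ni x\}$. $A$ is $e^*$-open if $A\subseteq cl(int(\delta\text{-}cl(A)))$; $e^*$-closed if its complement is $e^*$-open. $e^*\text{-}cl(A)$ is the intersection of all $e^*$-closed sets containing $A$. The $e^*$-$\theta$-closure of $A$ is $e^*\text{-}cl_\theta(A)=\{x\in X : e^*\text{-}cl(U)\cap A\neq\emptyset \text{ for every } e^*\text{-open } U\ni x\}$. $A$ is $e^*$-$\theta$-closed if $A=e^*\text{-}cl_\theta(A)$; $e^*$-$\theta$-open if its complement is $e^*$-$\theta$-closed. The $e^*$-$\theta$-kernel of $A$ is $e^*\text{-}ker_\theta(A)=\bigcap\{U : U \text{ is } e^*\text{-}\theta\text{-open in } X \text{ and } A\subseteq U\}$. The space $X$ is slightly $e^*$-$\theta$-$R_0$ if $\bigcap\{e^*\text{-}cl_\theta(\{x\}) : x\in X\}=\emptyset$ (the intersection is taken as subsets of $X$). *)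

theory Defs
  imports "HOL-Analysis.Abstract_Topology"
begin

(* Spaces are arbitrary values X :: 'a topology with underlying set topspace X (possibly empty,
   no separation axioms); all operators below are meant for subsets of topspace X. *)

definition delta_closure_of :: "'a topology \<Rightarrow> 'a set \<Rightarrow> 'a set" (infixr "delta'_closure'_of" 80) where
  "X delta_closure_of A =
     {x \<in> topspace X. \<forall>U. openin X U \<and> x \<in> U \<longrightarrow>
        (X interior_of (X closure_of U)) \<inter> A \<noteq> {}}"

(* The inclusion forces A to be a subset of topspace X, since closures are. *)
definition estar_openin :: "'a topology \<Rightarrow> 'a set \<Rightarrow> bool" where
  "estar_openin X A \<longleftrightarrow>
     A \<subseteq> X closure_of (X interior_of (X delta_closure_of A))"

definition estar_closedin :: "'a topology \<Rightarrow> 'a set \<Rightarrow> bool" where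
  "estar_closedin X A \<longleftrightarrow> A \<subseteq> topspace X \<and> estar_openin X (topspace X - A)"

(* For A inside topspace X the intersected family contains topspace X, so it is never empty. *)
definition estar_closure_of :: "'a topology \<Rightarrow> 'a set \<Rightarrow> 'a set" (infixr "estar'_closure'_of" 80) where
  "X estar_closure_of A = \<Inter>{F. estar_closedin X F \<and> A \<subseteq> F}"

definition estar_theta_closure_of :: "'a topology \<Rightarrow> 'a set \<Rightarrow> 'a set"
    (infixr "estar'_theta'_closure'_of" 80) where
  "X estar_theta_closure_of A =
     {x \<in> topspace X. \<forall>U. estar_openin X U \<and> x \<in> U \<longrightarrow> (X estar_closure_of U) \<inter> A \<noteq> {}}"

definition estar_theta_closedin :: "'a topology \<Rightarrow> 'a set \<Rightarrow> bool" where
  "estar_theta_closedin X A \<longleftrightarrow> A = X estar_theta_closure_of A"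

definition estar_theta_openin :: "'a topology \<Rightarrow> 'a set \<Rightarrow> bool" where
  "estar_theta_openin X A \<longleftrightarrow> A \<subseteq> topspace X \<and> estar_theta_closedin X (topspace X - A)"

(* As for the closure, the family contains topspace X whenever A is a subset of it. *)
definition estar_theta_kernel_of :: "'a topology \<Rightarrow> 'a set \<Rightarrow> 'a set"
    (infixr "estar'_theta'_kernel'_of" 80) where
  "X estar_theta_kernel_of A = \<Inter>{U. estar_theta_openin X U \<and> A \<subseteq> U}"

(* Intersecting with topspace X makes this an intersection of subsets of the space; it matters
   only for the empty space, where the indexed family is empty. *)
definition slightly_estar_theta_R0 :: "'a topology \<Rightarrow> bool" where
  "slightly_estar_theta_R0 X \<longleftrightarrow>
     topspace X \<inter> (\<Inter>x\<in>topspace X. X estar_theta_closure_of {x}) = {}"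

end

theory Submission
  imports Defs
begin

text \<open>
  The theorem rests on the duality between kernels and closures of points:
  \<open>y\<close> lies in the \<open>e\<^sup>*\<close>-\<open>\<theta>\<close>-kernel of \<open>{x}\<close> exactly when \<open>x\<close> lies in the
  \<open>e\<^sup>*\<close>-\<open>\<theta>\<close>-closure of \<open>{y}\<close> (lemma \<open>mem_estar_theta_kernel_of_singleton_iff\<close>). Hence the kernel of
  \<open>{x}\<close> is the whole space iff \<open>x\<close> belongs to the \<open>e\<^sup>*\<close>-\<open>\<theta>\<close>-closure of every point, that is, iff
  \<open>x\<close> witnesses that the intersection of all these closures is nonempty.

  The duality needs the closure of a point to be \<open>e\<^sup>*\<close>-\<open>\<theta>\<close>-closed, so that its complement is
  available as a separating \<open>e\<^sup>*\<close>-\<open>\<theta>\<close>-open set. A \<open>\<theta>\<close>-type closure operator is not idempotent in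
  general; this one is, because the \<open>e\<^sup>*\<close>-closure of an \<open>e\<^sup>*\<close>-open set is again \<open>e\<^sup>*\<close>-open (lemma
  \<open>estar_openin_estar_closure_of\<close>). If some \<open>e\<^sup>*\<close>-open \<open>U\<close> around \<open>x\<close> has an \<open>e\<^sup>*\<close>-closure \<open>V\<close>
  disjoint from \<open>A\<close>, then \<open>V\<close>, which is \<open>e\<^sup>*\<close>-open and its own \<open>e\<^sup>*\<close>-closure, excludes each of its
  points from the \<open>e\<^sup>*\<close>-\<open>\<theta>\<close>-closure of \<open>A\<close>, and so it separates \<open>x\<close> from that closure too.
\<close>

lemma delta_closure_of_mono:
  "A \<subseteq> B \<Longrightarrow> X delta_closure_of A \<subseteq> X delta_closure_of B"
  unfolding delta_closure_of_def by blast

lemma estar_openin_subset_topspace: "estar_openin X A \<Longrightarrow> A \<subseteq> topspace X"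
  unfolding estar_openin_def by (meson closure_of_subset_topspace order_trans)

lemma openin_imp_estar_openin:
  assumes "openin X A"
  shows "estar_openin X A"
proof -
  have "U \<subseteq> X interior_of (X closure_of U)" if "openin X U" for U
    by (simp add: closure_of_subset interior_of_maximal openin_subset that)
  then have "A \<subseteq> X delta_closure_of A"
    unfolding delta_closure_of_def using openin_subset[OF assms] by blast
  then have "A \<subseteq> X interior_of (X delta_closure_of A)"
    by (simp add: assms interior_of_maximal)
  then show ?thesis
    unfolding estar_openin_def
    by (meson closure_of_subset interior_of_subset_topspace order_trans)
qed

lemma closedin_imp_estar_closedin: "closedin X F \<Longrightarrow> estar_closedin X F"
  unfolding estar_closedin_def closedin_def by (simp add: openin_imp_estar_openin)

lemma estar_closure_of_superset: "A \<subseteq> X estar_closure_of A"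
  unfolding estar_closure_of_def by blast

lemma estar_closure_of_idem:
  "X estar_closure_of (X estar_closure_of A) = X estar_closure_of A"
  unfolding estar_closure_of_def by blast

text \<open>
  The set \<open>cl(int(\<delta>-cl(U)))\<close> that witnesses \<open>e\<^sup>*\<close>-openness of \<open>U\<close> is closed, hence \<open>e\<^sup>*\<close>-closed, so it
  also bounds the \<open>e\<^sup>*\<close>-closure of \<open>U\<close>.
\<close>
lemma estar_openin_estar_closure_of:
  assumes "estar_openin X U"
  shows "estar_openin X (X estar_closure_of U)"
proof -
  let ?F = "X closure_of (X interior_of (X delta_closure_of U))"
  have "X estar_closure_of U \<subseteq> ?F"
    using assms closedin_imp_estar_closedin[OF closedin_closure_of]
    unfolding estar_closure_of_def estar_openin_def by blast
  also have "?F \<subseteq> X closure_of (X interior_of (X delta_closure_of (X estar_closure_of U)))"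
    by (intro closure_of_mono interior_of_mono delta_closure_of_mono estar_closure_of_superset)
  finally show ?thesis
    unfolding estar_openin_def .
qed

lemma estar_theta_closure_of_subset_topspace: "X estar_theta_closure_of A \<subseteq> topspace X"
  unfolding estar_theta_closure_of_def by blast

lemma estar_theta_closure_of_mono:
  "A \<subseteq> B \<Longrightarrow> X estar_theta_closure_of A \<subseteq> X estar_theta_closure_of B"
  unfolding estar_theta_closure_of_def by blast

lemma estar_theta_closure_of_superset:
  "A \<subseteq> topspace X \<Longrightarrow> A \<subseteq> X estar_theta_closure_of A"
  unfolding estar_theta_closure_of_def using estar_closure_of_superset by fastforce

lemma estar_theta_closedin_estar_theta_closure_of:
  "estar_theta_closedin X (X estar_theta_closure_of A)"
proof -
  let ?C = "X estar_theta_closure_of A"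
  have "x \<in> ?C" if x: "x \<in> X estar_theta_closure_of ?C" for x
  proof (rule ccontr)
    assume "x \<notin> ?C"
    moreover have "x \<in> topspace X"
      using x by (rule subsetD[OF estar_theta_closure_of_subset_topspace])
    ultimately obtain U where U: "estar_openin X U" "x \<in> U" "X estar_closure_of U \<inter> A = {}"
      unfolding estar_theta_closure_of_def by blast
    let ?V = "X estar_closure_of U"
    have "estar_openin X ?V"
      using U(1) by (rule estar_openin_estar_closure_of)
    moreover have "X estar_closure_of ?V = ?V"
      by (rule estar_closure_of_idem)
    ultimately have "v \<notin> ?C" if "v \<in> ?V" for v
      using U(3) that unfolding estar_theta_closure_of_def by force
    then have "?V \<inter> ?C = {}"
      by blast
    moreover have "?V \<inter> ?C \<noteq> {}"
      using x U(1,2) by (simp add: estar_theta_closure_of_def[of X ?C])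
    ultimately show False
      by contradiction
  qed
  then have "X estar_theta_closure_of ?C \<subseteq> ?C"
    by (rule subsetI)
  then show ?thesis
    unfolding estar_theta_closedin_def
    using estar_theta_closure_of_superset[OF estar_theta_closure_of_subset_topspace]
    by (intro equalityI)
qed

lemma estar_theta_openin_topspace: "estar_theta_openin X (topspace X)"
proof -
  have "X estar_theta_closure_of {} = {}"
  proof -
    have "estar_openin X (topspace X)"
      by (simp add: openin_imp_estar_openin)
    then show ?thesis
      unfolding estar_theta_closure_of_def by blast
  qed
  then show ?thesis
    by (simp add: estar_theta_openin_def estar_theta_closedin_def)
qed

lemma estar_theta_kernel_of_subset_topspace:
  "A \<subseteq> topspace X \<Longrightarrow> X estar_theta_kernel_of A \<subseteq> topspace X"
  unfolding estar_theta_kernel_of_def using estar_theta_openin_topspace by blast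

text \<open>
  Both sides say that no \<open>e\<^sup>*\<close>-\<open>\<theta>\<close>-open set contains \<open>x\<close> but not \<open>y\<close>: for the closure, the complement
  of the \<open>e\<^sup>*\<close>-\<open>\<theta>\<close>-closure of \<open>{y}\<close> is the largest candidate for such a set.
\<close>
lemma mem_estar_theta_kernel_of_singleton_iff:
  assumes x: "x \<in> topspace X" and y: "y \<in> topspace X"
  shows "y \<in> X estar_theta_kernel_of {x} \<longleftrightarrow> x \<in> X estar_theta_closure_of {y}"
proof
  let ?C = "X estar_theta_closure_of {y}"
  assume ker: "y \<in> X estar_theta_kernel_of {x}"
  have "topspace X - (topspace X - ?C) = ?C"
    by (rule double_diff[OF estar_theta_closure_of_subset_topspace order_refl])
  then have "estar_theta_openin X (topspace X - ?C)"
    by (simp add: estar_theta_openin_def estar_theta_closedin_estar_theta_closure_of)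
  moreover have "y \<in> ?C"
    using y estar_theta_closure_of_superset[of "{y}" X] by simp
  ultimately show "x \<in> ?C"
    using ker x unfolding estar_theta_kernel_of_def by blast
next
  assume cl: "x \<in> X estar_theta_closure_of {y}"
  have "y \<in> U" if U: "estar_theta_openin X U" "x \<in> U" for U
  proof (rule ccontr)
    assume "y \<notin> U"
    then have "X estar_theta_closure_of {y} \<subseteq> X estar_theta_closure_of (topspace X - U)"
      using y by (intro estar_theta_closure_of_mono) blast
    also have "\<dots> = topspace X - U"
      using U(1) unfolding estar_theta_openin_def estar_theta_closedin_def by simp
    finally show False
      using cl U(2) by blast
  qed
  then show "y \<in> X estar_theta_kernel_of {x}"
    unfolding estar_theta_kernel_of_def by blast
qed

theorem theorem5p8:
  fixes X :: "'a topology"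
  shows "slightly_estar_theta_R0 X \<longleftrightarrow>
    (\<forall>x\<in>topspace X. X estar_theta_kernel_of {x} \<noteq> topspace X)"
proof -
  have "X estar_theta_kernel_of {x} = topspace X
      \<longleftrightarrow> x \<in> (\<Inter>y\<in>topspace X. X estar_theta_closure_of {y})"
    if x: "x \<in> topspace X" for x
  proof -
    have "X estar_theta_kernel_of {x} \<subseteq> topspace X"
      using x by (simp add: estar_theta_kernel_of_subset_topspace)
    then have "X estar_theta_kernel_of {x} = topspace X
        \<longleftrightarrow> (\<forall>y\<in>topspace X. y \<in> X estar_theta_kernel_of {x})"
      by auto
    also have "\<dots> \<longleftrightarrow> (\<forall>y\<in>topspace X. x \<in> X estar_theta_closure_of {y})"
      using mem_estar_theta_kernel_of_singleton_iff[OF x] by simp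
    finally show ?thesis
      by simp
  qed
  then show ?thesis
    unfolding slightly_estar_theta_R0_def disjoint_iff by (simp add: Ball_def)
qed

end
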